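(* Let $\mathcal{S}$ be a semiring with a separating set $H$ of homomorphisms $h:\mathcal{S}\to\mathbb{B}$. Let $\pi_A,\pi_B$ be $\mathcal{S}$-interpretations, $\bar a\in A^n$, $\bar b\in B^n$, and $m\in\mathbb{N}$. The following are equivalent: (1) Duplicator has a winning strategy in $HG_m(H,\pi_A,\bar a,\pi_B,\bar b)$; (2) for each $h\in H$: $h(\pi_B[\![\chi^m_{h\circ\pi_A,\bar a}(\bar b)]\!])=h(\pi_A[\![\chi^m_{h\circ\pi_B,\bar b}(\bar a)]\!])=1$; (3) $(\pi_A,\bar a)\equiv_m(\pi_B,\bar b)$.
   Context: A semiring is $\mathcal{S}=(S,+,\cdot,0,1)$ with $0\ne1$, commutative monoids, distributivity, $0\cdot s=0$, naturally ordered. $\mathbb{B}=(\{0,1\},\vee,\wedge,0,1)$. A set $H$ of semiring homomorphisms $\mathcal{S}\to\mathbb{B}$ is separating if for all $s\ne t$ in $S$ some $h\in H$ has $h(s)\ne h(t)$ (homomorphisms are assumed compatible with the infinitary operations when infinite universes are used). For a finite relational vocabulary $\tau$, an $\mathcal{S}$-interpretation maps the literals $R\bar a,\neg R\bar a$ over its universe to $S$; $h\circ\pi$ is then a $\mathbb{B}$-interpretation (not necessarily model-defining). Formulae in negation normal form are evaluated with equalities by truth value, literals by $\pi$, $\vee,\exists$ as sums, $\wedge,\forall$ as products over the universe; $\equiv_m$: equal values for all formulae of quantifier rank $\le m$. For $\mathbb{B}$-interpretations $\rho_0,\rho_1$, the one-sided game $G^{\le}_m(\rho_0,\bar c,\rho_1,\bar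 d)$ has $m$ rounds in which Spoiler picks an element of one universe and Duplicator one of the other; Duplicator wins iff the final tuples $\bar c',\bar d'$ have the same equality pattern and $\rho_0(L(\bar c'))\le\rho_1(L(\bar d'))$ for all $\tau$-literals $L$. The homomorphism game $HG_m(H,\pi_A,\bar a,\pi_B,\bar b)$: Spoiler chooses $h\in H$ and either $(\rho_0,\bar c,\rho_1,\bar d)=(h\circ\pi_A,\bar a,h\circ\pi_B,\bar b)$ or $(h\circ\pi_B,\bar b,h\circ\pi_A,\bar a)$; then $G^{\le}_m(\rho_0,\bar c,\rho_1,\bar d)$ is played. For a $\mathbb{B}$-interpretation $\rho$ with universe $C$ and $\bar c\in C^n$: $\varphi^=_{\bar c}(\bar x)$ is the conjunction of $x_i=x_j$ for $c_i=c_j$ and $x_i\ne x_j$ for $c_i\ne c_j$; $\chi^0_{\rho,\bar c}(\bar x)=\varphi^=_{\bar c}(\bar x)\wedge\bigwedge\{L(\bar x):\rho(L(\bar c))=1\}$ ($L$ ranging over $\tau$-literals in $x_1,\dots,x_n$); $\chi^{m+1}_{\rho,\bar c}(\bar x)=\bigwedge_{c\in C}\exists x\,\chi^m_{\rho,\bar c c}(\bar x,x)\wedge\forall x\bigvee_{c\in C}\chi^m_{\rho,\bar c c}(\bar x,x)$ (over the finitely many distinct formulae). *)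

theory Defs
  imports Main
begin

text \<open>
  A semiring is a type of sort \<open>{comm_semiring_1, canonically_ordered_monoid_add}\<close>; the second
  class says that \<open>a \<le> b \<longleftrightarrow> (\<exists>c. b = a + c)\<close> is a partial order.  The Boolean semiring is the
  type \<open>bool\<close> with disjunction, conjunction, \<open>False\<close> and \<open>True\<close>.  A finite relational vocabulary is
  a partial map from symbols to arities with finite domain.
\<close>

type_synonym 'r vocabulary = "'r \<rightharpoonup> nat"

definition semiring_hom :: "('s::comm_semiring_1 \<Rightarrow> bool) \<Rightarrow> bool" where
  "semiring_hom h \<longleftrightarrow>
     h 0 = False \<and> h 1 = True \<and>
     (\<forall>s t. h (s + t) = (h s \<or> h t)) \<and> (\<forall>s t. h (s * t) = (h s \<and> h t))"

definition separating :: "('s \<Rightarrow> bool) set \<Rightarrow> bool" where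
  "separating H \<longleftrightarrow> (\<forall>s t. s \<noteq> t \<longrightarrow> (\<exists>h\<in>H. h s \<noteq> h t))"

text \<open>
  Sums and products of families \<open>f\<close> over arbitrary index sets: they extend the finite
  operations, and only the values of \<open>f\<close> on the index set matter.
\<close>

definition infinitary_operations ::
  "(('u \<Rightarrow> 's) \<Rightarrow> 'u set \<Rightarrow> 's::comm_semiring_1) \<Rightarrow> (('u \<Rightarrow> 's) \<Rightarrow> 'u set \<Rightarrow> 's) \<Rightarrow> bool" where
  "infinitary_operations isum iprod \<longleftrightarrow>
     (\<forall>f I. finite I \<longrightarrow> isum f I = sum f I \<and> iprod f I = prod f I) \<and>
     (\<forall>f g I. (\<forall>i\<in>I. f i = g i) \<longrightarrow> isum f I = isum g I \<and> iprod f I = iprod g I)"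

definition infinitary_compatible ::
  "(('u \<Rightarrow> 's) \<Rightarrow> 'u set \<Rightarrow> 's) \<Rightarrow> (('u \<Rightarrow> 's) \<Rightarrow> 'u set \<Rightarrow> 's) \<Rightarrow> 'u set \<Rightarrow> ('s \<Rightarrow> bool) \<Rightarrow> bool" where
  "infinitary_compatible isum iprod I h \<longleftrightarrow>
     (\<forall>f. h (isum f I) = (\<exists>i\<in>I. h (f i)) \<and> h (iprod f I) = (\<forall>i\<in>I. h (f i)))"

datatype (dead 'r, 'v) lit = Pos 'r "'v list" | Neg 'r "'v list"

text \<open>
  An \<open>'s\<close>-interpretation is a universe together with a valuation of its literals.  Valuations are
  total functions on \<open>('r, 'u) lit\<close>; only literals of the right arity over the universe are ever
  looked at.
\<close>

type_synonym ('r, 'u, 's) interp = "('r, 'u) lit \<Rightarrow> 's"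

text \<open>The \<open>\<tau>\<close>-literals in the variables \<open>0, \<dots>, n - 1\<close>; \<open>L(c)\<close> is \<open>inst c L\<close>.\<close>

fun literal_over :: "'r vocabulary \<Rightarrow> nat \<Rightarrow> ('r, nat) lit \<Rightarrow> bool" where
  "literal_over \<tau> n (Pos R vs) \<longleftrightarrow> \<tau> R = Some (length vs) \<and> set vs \<subseteq> {..<n}"
| "literal_over \<tau> n (Neg R vs) \<longleftrightarrow> \<tau> R = Some (length vs) \<and> set vs \<subseteq> {..<n}"

definition inst :: "'u list \<Rightarrow> ('r, nat) lit \<Rightarrow> ('r, 'u) lit" where
  "inst c L = map_lit (\<lambda>i. c ! i) L"

text \<open>Formulae in negation normal form; \<open>Tru\<close> and \<open>Fls\<close> are the empty conjunction and disjunction.\<close>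

datatype 'r fm =
    Tru | Fls
  | Eq nat nat | Neq nat nat
  | Lit "('r, nat) lit"
  | Or "'r fm" "'r fm" | And "'r fm" "'r fm"
  | Ex nat "'r fm" | All nat "'r fm"

primrec in_vocabulary :: "'r vocabulary \<Rightarrow> 'r fm \<Rightarrow> bool" where
  "in_vocabulary \<tau> Tru = True"
| "in_vocabulary \<tau> Fls = True"
| "in_vocabulary \<tau> (Eq i j) = True"
| "in_vocabulary \<tau> (Neq i j) = True"
| "in_vocabulary \<tau> (Lit L) = (\<exists>n. literal_over \<tau> n L)"
| "in_vocabulary \<tau> (Or \<phi> \<psi>) = (in_vocabulary \<tau> \<phi> \<and> in_vocabulary \<tau> \<psi>)"
| "in_vocabulary \<tau> (And \<phi> \<psi>) = (in_vocabulary \<tau> \<phi> \<and> in_vocabulary \<tau> \<psi>)"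
| "in_vocabulary \<tau> (Ex i \<phi>) = in_vocabulary \<tau> \<phi>"
| "in_vocabulary \<tau> (All i \<phi>) = in_vocabulary \<tau> \<phi>"

primrec free_vars :: "'r fm \<Rightarrow> nat set" where
  "free_vars Tru = {}"
| "free_vars Fls = {}"
| "free_vars (Eq i j) = {i, j}"
| "free_vars (Neq i j) = {i, j}"
| "free_vars (Lit L) = set_lit L"
| "free_vars (Or \<phi> \<psi>) = free_vars \<phi> \<union> free_vars \<psi>"
| "free_vars (And \<phi> \<psi>) = free_vars \<phi> \<union> free_vars \<psi>"
| "free_vars (Ex i \<phi>) = free_vars \<phi> - {i}"
| "free_vars (All i \<phi>) = free_vars \<phi> - {i}"

primrec quantifier_rank :: "'r fm \<Rightarrow> nat" where
  "quantifier_rank Tru = 0"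
| "quantifier_rank Fls = 0"
| "quantifier_rank (Eq i j) = 0"
| "quantifier_rank (Neq i j) = 0"
| "quantifier_rank (Lit L) = 0"
| "quantifier_rank (Or \<phi> \<psi>) = max (quantifier_rank \<phi>) (quantifier_rank \<psi>)"
| "quantifier_rank (And \<phi> \<psi>) = max (quantifier_rank \<phi>) (quantifier_rank \<psi>)"
| "quantifier_rank (Ex i \<phi>) = Suc (quantifier_rank \<phi>)"
| "quantifier_rank (All i \<phi>) = Suc (quantifier_rank \<phi>)"

primrec eval ::
  "(('u \<Rightarrow> 's) \<Rightarrow> 'u set \<Rightarrow> 's::comm_semiring_1) \<Rightarrow> (('u \<Rightarrow> 's) \<Rightarrow> 'u set \<Rightarrow> 's) \<Rightarrow>
   'u set \<Rightarrow> ('r, 'u, 's) interp \<Rightarrow> (nat \<Rightarrow> 'u) \<Rightarrow> 'r fm \<Rightarrow> 's" where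
  "eval isum iprod U \<pi> e Tru = 1"
| "eval isum iprod U \<pi> e Fls = 0"
| "eval isum iprod U \<pi> e (Eq i j) = (if e i = e j then 1 else 0)"
| "eval isum iprod U \<pi> e (Neq i j) = (if e i \<noteq> e j then 1 else 0)"
| "eval isum iprod U \<pi> e (Lit L) = \<pi> (map_lit e L)"
| "eval isum iprod U \<pi> e (Or \<phi> \<psi>) = eval isum iprod U \<pi> e \<phi> + eval isum iprod U \<pi> e \<psi>"
| "eval isum iprod U \<pi> e (And \<phi> \<psi>) = eval isum iprod U \<pi> e \<phi> * eval isum iprod U \<pi> e \<psi>"
| "eval isum iprod U \<pi> e (Ex i \<phi>) = isum (\<lambda>u. eval isum iprod U \<pi> (e(i := u)) \<phi>) U"
| "eval isum iprod U \<pi> e (All i \<phi>) = iprod (\<lambda>u. eval isum iprod U \<pi> (e(i := u)) \<phi>) U"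

text \<open>
  The value of \<open>\<phi>(x\<^sub>0, \<dots>, x\<^bsub>n-1\<^esub>)\<close> at an \<open>n\<close>-tuple; meaningful when
  the free variables of \<open>\<phi>\<close> are below \<open>n\<close>.
\<close>

definition eval_tuple ::
  "(('u \<Rightarrow> 's) \<Rightarrow> 'u set \<Rightarrow> 's::comm_semiring_1) \<Rightarrow> (('u \<Rightarrow> 's) \<Rightarrow> 'u set \<Rightarrow> 's) \<Rightarrow>
   'u set \<Rightarrow> ('r, 'u, 's) interp \<Rightarrow> 'r fm \<Rightarrow> 'u list \<Rightarrow> 's" where
  "eval_tuple isum iprod U \<pi> \<phi> c = eval isum iprod U \<pi> (\<lambda>i. c ! i) \<phi>"

definition equiv_rank ::
  "(('u \<Rightarrow> 's) \<Rightarrow> 'u set \<Rightarrow> 's::comm_semiring_1) \<Rightarrow> (('u \<Rightarrow> 's) \<Rightarrow> 'u set \<Rightarrow> 's) \<Rightarrow>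
   'r vocabulary \<Rightarrow> nat \<Rightarrow> nat \<Rightarrow>
   'u set \<Rightarrow> ('r, 'u, 's) interp \<Rightarrow> 'u list \<Rightarrow>
   'u set \<Rightarrow> ('r, 'u, 's) interp \<Rightarrow> 'u list \<Rightarrow> bool" where
  "equiv_rank isum iprod \<tau> n m A \<pi>A a B \<pi>B b \<longleftrightarrow>
     (\<forall>\<phi>. in_vocabulary \<tau> \<phi> \<and> free_vars \<phi> \<subseteq> {..<n} \<and> quantifier_rank \<phi> \<le> m \<longrightarrow>
        eval_tuple isum iprod A \<pi>A \<phi> a = eval_tuple isum iprod B \<pi>B \<phi> b)"

text \<open>
  Conjunction and disjunction of a finite set of formulae, in some fixed order without repetitions.
\<close>

definition big_and :: "'r fm set \<Rightarrow> 'r fm" where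
  "big_and \<Phi> = foldr And (SOME \<phi>s. set \<phi>s = \<Phi> \<and> distinct \<phi>s) Tru"

definition big_or :: "'r fm set \<Rightarrow> 'r fm" where
  "big_or \<Phi> = foldr Or (SOME \<phi>s. set \<phi>s = \<Phi> \<and> distinct \<phi>s) Fls"

definition equality_formula :: "'u list \<Rightarrow> 'r fm" where
  "equality_formula c = big_and
     ({Eq i j | i j. i < length c \<and> j < length c \<and> c ! i = c ! j} \<union>
      {Neq i j | i j. i < length c \<and> j < length c \<and> c ! i \<noteq> c ! j})"

primrec characteristic_formula ::
  "'r vocabulary \<Rightarrow> 'u set \<Rightarrow> ('r, 'u, bool) interp \<Rightarrow> nat \<Rightarrow> 'u list \<Rightarrow> 'r fm" where
  "characteristic_formula \<tau> C \<rho> 0 = (\<lambda>c.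
     And (equality_formula c)
         (big_and (Lit ` {L. literal_over \<tau> (length c) L \<and> \<rho> (inst c L) = True})))"
| "characteristic_formula \<tau> C \<rho> (Suc m) = (\<lambda>c.
     And (big_and ((\<lambda>x. Ex (length c) (characteristic_formula \<tau> C \<rho> m (c @ [x]))) ` C))
         (All (length c) (big_or ((\<lambda>x. characteristic_formula \<tau> C \<rho> m (c @ [x])) ` C))))"

text \<open>
  The one-sided game.  A Spoiler move is an element of the first or of the second universe.  A
  strategy of Duplicator maps the nonempty sequence of Spoiler's moves so far to the reply to the
  last of them (the earlier replies are determined by the strategy).
\<close>

datatype 'u move = First 'u | Second 'u

type_synonym 'u strategy = "'u move list \<Rightarrow> 'u"

fun legal_move :: "'u set \<Rightarrow> 'u set \<Rightarrow> 'u move \<Rightarrow> bool" where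
  "legal_move C D (First x) \<longleftrightarrow> x \<in> C"
| "legal_move C D (Second y) \<longleftrightarrow> y \<in> D"

fun legal_reply :: "'u set \<Rightarrow> 'u set \<Rightarrow> 'u move \<Rightarrow> 'u \<Rightarrow> bool" where
  "legal_reply C D (First x) y \<longleftrightarrow> y \<in> D"
| "legal_reply C D (Second y) x \<longleftrightarrow> x \<in> C"

fun round_pair :: "'u move \<Rightarrow> 'u \<Rightarrow> 'u \<times> 'u" where
  "round_pair (First x) r = (x, r)"
| "round_pair (Second y) r = (r, y)"

definition rounds :: "'u strategy \<Rightarrow> 'u move list \<Rightarrow> ('u \<times> 'u) list" where
  "rounds \<sigma> ms = map (\<lambda>k. round_pair (ms ! k) (\<sigma> (take (Suc k) ms))) [0..<length ms]"

definition winning_final ::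
  "'r vocabulary \<Rightarrow> ('r, 'u, bool) interp \<Rightarrow> 'u list \<Rightarrow>
   ('r, 'u, bool) interp \<Rightarrow> 'u list \<Rightarrow> bool" where
  "winning_final \<tau> \<rho>0 c \<rho>1 d \<longleftrightarrow>
     (\<forall>i<length c. \<forall>j<length c. c ! i = c ! j \<longleftrightarrow> d ! i = d ! j) \<and>
     (\<forall>L. literal_over \<tau> (length c) L \<longrightarrow> \<rho>0 (inst c L) \<le> \<rho>1 (inst d L))"

definition winning_strategy ::
  "'r vocabulary \<Rightarrow> nat \<Rightarrow> 'u set \<Rightarrow> ('r, 'u, bool) interp \<Rightarrow> 'u list \<Rightarrow>
   'u set \<Rightarrow> ('r, 'u, bool) interp \<Rightarrow> 'u list \<Rightarrow> 'u strategy \<Rightarrow> bool" where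
  "winning_strategy \<tau> m C \<rho>0 c D \<rho>1 d \<sigma> \<longleftrightarrow>
     (\<forall>ms. ms \<noteq> [] \<and> length ms \<le> m \<and> list_all (legal_move C D) ms \<longrightarrow>
        legal_reply C D (last ms) (\<sigma> ms)) \<and>
     (\<forall>ms. length ms = m \<and> list_all (legal_move C D) ms \<longrightarrow>
        winning_final \<tau> \<rho>0 (c @ map fst (rounds \<sigma> ms)) \<rho>1 (d @ map snd (rounds \<sigma> ms)))"

text \<open>
  The homomorphism game.  Spoiler's opening move is a homomorphism together with a direction
  (\<open>True\<close> for \<open>A\<close> to \<open>B\<close>), so a strategy of Duplicator is a strategy in the one-sided game for
  each opening move.
\<close>

definition duplicator_wins_HG ::
  "'r vocabulary \<Rightarrow> nat \<Rightarrow> ('s \<Rightarrow> bool) set \<Rightarrow>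
   'u set \<Rightarrow> ('r, 'u, 's) interp \<Rightarrow> 'u list \<Rightarrow>
   'u set \<Rightarrow> ('r, 'u, 's) interp \<Rightarrow> 'u list \<Rightarrow> bool" where
  "duplicator_wins_HG \<tau> m H A \<pi>A a B \<pi>B b \<longleftrightarrow>
     (\<exists>S :: ('s \<Rightarrow> bool) \<Rightarrow> bool \<Rightarrow> 'u strategy. \<forall>h\<in>H.
        winning_strategy \<tau> m A (h \<circ> \<pi>A) a B (h \<circ> \<pi>B) b (S h True) \<and>
        winning_strategy \<tau> m B (h \<circ> \<pi>B) b A (h \<circ> \<pi>A) a (S h False))"

end

theory Submission imports Defs begin

text \<open>
  A homomorphism into the Boolean semiring commutes with the evaluation of formulae, so for each
  \<open>h \<in> H\<close> everything reduces to ordinary satisfaction in the Boolean interpretations \<open>h \<circ> \<pi>\<close>,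
  where literals occur only positively.  There, both Duplicator winning the one-sided game and
  the characteristic formula holding say that a one-sided back-and-forth system exists, and such
  a system preserves truth of all formulae of the given quantifier rank.  Preservation in both
  directions for all \<open>h\<close> gives equal values because \<open>H\<close> is separating.
\<close>

section \<open>Boolean satisfaction\<close>

text \<open>Values in the Boolean semiring, written with the logical connectives. Negated literals
  are looked up in \<open>\<rho>\<close> like positive ones, so \<open>Neg R vs\<close> and
  \<open>Pos R vs\<close> need not be complementary; this is the generality that
  \<open>h \<circ> \<pi>\<close> requires.\<close>

primrec satisfies :: "'u set \<Rightarrow> ('r, 'u, bool) interp \<Rightarrow> (nat \<Rightarrow> 'u) \<Rightarrow> 'r fm \<Rightarrow> bool" where
  "satisfies U \<rho> e Tru = True"
| "satisfies U \<rho> e Fls = False"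
| "satisfies U \<rho> e (Eq i j) = (e i = e j)"
| "satisfies U \<rho> e (Neq i j) = (e i \<noteq> e j)"
| "satisfies U \<rho> e (Lit L) = \<rho> (map_lit e L)"
| "satisfies U \<rho> e (Or \<phi> \<psi>) = (satisfies U \<rho> e \<phi> \<or> satisfies U \<rho> e \<psi>)"
| "satisfies U \<rho> e (And \<phi> \<psi>) = (satisfies U \<rho> e \<phi> \<and> satisfies U \<rho> e \<psi>)"
| "satisfies U \<rho> e (Ex i \<phi>) = (\<exists>u\<in>U. satisfies U \<rho> (e(i := u)) \<phi>)"
| "satisfies U \<rho> e (All i \<phi>) = (\<forall>u\<in>U. satisfies U \<rho> (e(i := u)) \<phi>)"

lemma satisfies_cong:
  assumes "\<And>i. i \<in> free_vars \<phi> \<Longrightarrow> e i = e' i"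
  shows "satisfies U \<rho> e \<phi> = satisfies U \<rho> e' \<phi>"
  using assms
proof (induction \<phi> arbitrary: e e')
  case (Lit L)
  then have "map_lit e L = map_lit e' L" by (intro lit.map_cong) auto
  then show ?case by simp
next
  case (Or \<phi> \<psi>)
  have "satisfies U \<rho> e \<phi> = satisfies U \<rho> e' \<phi>" "satisfies U \<rho> e \<psi> = satisfies U \<rho> e' \<psi>"
    by (auto intro!: Or.IH Or.prems)
  then show ?case by simp
next
  case (And \<phi> \<psi>)
  have "satisfies U \<rho> e \<phi> = satisfies U \<rho> e' \<phi>" "satisfies U \<rho> e \<psi> = satisfies U \<rho> e' \<psi>"
    by (auto intro!: And.IH And.prems)
  then show ?case by simp
next
  case (Ex i \<phi>)
  have "satisfies U \<rho> (e(i := u)) \<phi> = satisfies U \<rho> (e'(i := u)) \<phi>" for u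
    by (rule Ex.IH) (auto simp: Ex.prems)
  then show ?case by simp
next
  case (All i \<phi>)
  have "satisfies U \<rho> (e(i := u)) \<phi> = satisfies U \<rho> (e'(i := u)) \<phi>" for u
    by (rule All.IH) (auto simp: All.prems)
  then show ?case by simp
qed auto

section \<open>Homomorphisms into the Boolean semiring commute with evaluation\<close>

lemma semiring_hom_sum:
  assumes "semiring_hom h" "finite I"
  shows "h (sum f I) = (\<exists>i\<in>I. h (f i))"
  using assms(2) by induction (use assms(1) in \<open>auto simp: semiring_hom_def\<close>)

lemma semiring_hom_prod:
  assumes "semiring_hom h" "finite I"
  shows "h (prod f I) = (\<forall>i\<in>I. h (f i))"
  using assms(2) by induction (use assms(1) in \<open>auto simp: semiring_hom_def\<close>)

text \<open>The theorem assumes compatibility for infinite universes only. Over a finite one the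
  operations are ordinary sums and products, which every homomorphism respects, so both cases can be
  treated alike.\<close>

lemma infinitary_compatible_finite:
  assumes "infinitary_operations isum iprod" "semiring_hom h" "finite I"
  shows "infinitary_compatible isum iprod I h"
  using assms
  by (simp add: infinitary_operations_def infinitary_compatible_def
      semiring_hom_sum semiring_hom_prod)

text \<open>In negation normal form every connective is a semiring operation that \<open>h\<close>
  respects, and there is no negation to pass through. Infinitary compatibility covers the
  quantifiers.\<close>

lemma hom_eval:
  assumes "semiring_hom h" "infinitary_compatible isum iprod U h"
  shows "h (eval isum iprod U \<pi> e \<phi>) = satisfies U (h \<circ> \<pi>) e \<phi>"
  by (induction \<phi> arbitrary: e)
    (use assms in \<open>auto simp: semiring_hom_def infinitary_compatible_def\<close>)

section \<open>Characteristic formulae\<close>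

text \<open>Bundles the side conditions on formulae in \<open>equiv_rank\<close>, so that a single
  induction carries all of them.\<close>

definition ranked_formula :: "'r vocabulary \<Rightarrow> nat \<Rightarrow> nat \<Rightarrow> 'r fm \<Rightarrow> bool" where
  "ranked_formula \<tau> n m \<phi> \<longleftrightarrow>
     in_vocabulary \<tau> \<phi> \<and> free_vars \<phi> \<subseteq> {..<n} \<and> quantifier_rank \<phi> \<le> m"

section \<open>Finite conjunctions and disjunctions\<close>

lemma set_some_distinct_list:
  assumes "finite X"
  shows "set (SOME xs. set xs = X \<and> distinct xs) = X"
  using someI_ex[OF finite_distinct_list[OF assms]] by simp

lemma satisfies_big_and:
  assumes "finite \<Phi>"
  shows "satisfies U \<rho> e (big_and \<Phi>) = (\<forall>\<phi>\<in>\<Phi>. satisfies U \<rho> e \<phi>)"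
proof -
  have "satisfies U \<rho> e (foldr And \<phi>s Tru) = (\<forall>\<phi>\<in>set \<phi>s. satisfies U \<rho> e \<phi>)" for \<phi>s
    by (induction \<phi>s) auto
  then show ?thesis unfolding big_and_def by (simp add: set_some_distinct_list[OF assms])
qed

lemma satisfies_big_or:
  assumes "finite \<Phi>"
  shows "satisfies U \<rho> e (big_or \<Phi>) = (\<exists>\<phi>\<in>\<Phi>. satisfies U \<rho> e \<phi>)"
proof -
  have "satisfies U \<rho> e (foldr Or \<phi>s Fls) = (\<exists>\<phi>\<in>set \<phi>s. satisfies U \<rho> e \<phi>)" for \<phi>s
    by (induction \<phi>s) auto
  then show ?thesis unfolding big_or_def by (simp add: set_some_distinct_list[OF assms])
qed

lemma ranked_formula_big_and:
  assumes "finite \<Phi>" "\<And>\<phi>. \<phi> \<in> \<Phi> \<Longrightarrow> ranked_formula \<tau> n m \<phi>"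
  shows "ranked_formula \<tau> n m (big_and \<Phi>)"
proof -
  have "(\<forall>\<phi>\<in>set \<phi>s. ranked_formula \<tau> n m \<phi>) \<Longrightarrow> ranked_formula \<tau> n m (foldr And \<phi>s Tru)" for \<phi>s
    by (induction \<phi>s) (auto simp: ranked_formula_def)
  then show ?thesis unfolding big_and_def by (simp add: set_some_distinct_list assms)
qed

lemma ranked_formula_big_or:
  assumes "finite \<Phi>" "\<And>\<phi>. \<phi> \<in> \<Phi> \<Longrightarrow> ranked_formula \<tau> n m \<phi>"
  shows "ranked_formula \<tau> n m (big_or \<Phi>)"
proof -
  have "(\<forall>\<phi>\<in>set \<phi>s. ranked_formula \<tau> n m \<phi>) \<Longrightarrow> ranked_formula \<tau> n m (foldr Or \<phi>s Fls)" for \<phi>s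
    by (induction \<phi>s) (auto simp: ranked_formula_def)
  then show ?thesis unfolding big_or_def by (simp add: set_some_distinct_list assms)
qed

section \<open>Finiteness and syntactic bounds for literals, equality formulae and characteristic
  formulae\<close>

lemma finite_literal_over:
  assumes "finite (dom \<tau>)"
  shows "finite {L. literal_over \<tau> n L}"
proof -
  \<comment> \<open>Each symbol has a fixed arity, so its literals are indexed by lists of a single
    length over \<open>n\<close> variables.\<close>
  let ?P = "Sigma (dom \<tau>) (\<lambda>R. {vs. set vs \<subseteq> {..<n} \<and> length vs = the (\<tau> R)})"
  have "finite ?P"
    using assms by (auto intro: finite_lists_length_eq)
  moreover have "{L. literal_over \<tau> n L} \<subseteq> case_prod Pos ` ?P \<union> case_prod Neg ` ?P"
  proof
    fix L assume "L \<in> {L. literal_over \<tau> n L}"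
    then show "L \<in> case_prod Pos ` ?P \<union> case_prod Neg ` ?P"
      by (cases L) (auto simp: image_iff)
  qed
  ultimately show ?thesis by (meson finite_UnI finite_imageI finite_subset)
qed

text \<open>Separates the bound on the variables from the arity condition:
  \<open>in_vocabulary\<close> asks only for some bound, which a finite list always has, while
  \<open>free_vars\<close> supplies the bound \<open>n\<close>.\<close>

lemma literal_over_iff:
  "literal_over \<tau> n L \<longleftrightarrow> set_lit L \<subseteq> {..<n} \<and> (\<exists>k. literal_over \<tau> k L)"
proof (cases L)
  case (Pos R vs)
  have "\<exists>k. set vs \<subseteq> {..<k}" using finite_nat_set_iff_bounded[of "set vs"] by auto
  then show ?thesis using Pos by auto
next
  case (Neg R vs)
  have "\<exists>k. set vs \<subseteq> {..<k}" using finite_nat_set_iff_bounded[of "set vs"] by auto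
  then show ?thesis using Neg by auto
qed

lemma literal_over_map_lit:
  assumes "literal_over \<tau> k L" "f ` set_lit L \<subseteq> {..<n}"
  shows "literal_over \<tau> n (map_lit f L)"
  using assms by (cases L) auto

text \<open>A finite superset depending only on the length of the tuple, from which the equality
  formulae of all tuples of that length draw their conjuncts.\<close>

abbreviation equality_atoms :: "nat \<Rightarrow> 'r fm set" where
  "equality_atoms n \<equiv> case_prod Eq ` ({..<n} \<times> {..<n}) \<union> case_prod Neq ` ({..<n} \<times> {..<n})"

lemma equality_formula_atoms:
  "{Eq i j | i j. i < length c \<and> j < length c \<and> c ! i = c ! j} \<union>
   {Neq i j | i j. i < length c \<and> j < length c \<and> c ! i \<noteq> c ! j} \<subseteq> equality_atoms (length c)"
  by auto

lemma finite_equality_formula_atoms: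
  "finite ({Eq i j | i j. i < length c \<and> j < length c \<and> c ! i = c ! j} \<union>
   {Neq i j | i j. i < length c \<and> j < length c \<and> c ! i \<noteq> c ! j} :: 'r fm set)"
  by (rule finite_subset[OF equality_formula_atoms]) auto

lemma satisfies_equality_formula:
  "satisfies U \<rho> e (equality_formula c) \<longleftrightarrow>
     (\<forall>i<length c. \<forall>j<length c. c ! i = c ! j \<longleftrightarrow> e i = e j)"
  unfolding equality_formula_def satisfies_big_and[OF finite_equality_formula_atoms]
  by (auto simp: ball_Un) (metis satisfies.simps(3) satisfies.simps(4))+

lemma ranked_equality_formula: "ranked_formula \<tau> (length c) m (equality_formula c)"
  unfolding equality_formula_def
  by (rule ranked_formula_big_and[OF finite_equality_formula_atoms])
    (auto simp: ranked_formula_def)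

text \<open>This makes the conjunctions and disjunctions over a possibly infinite universe
  meaningful. They range over sets of formulae, and for fixed rank and tuple length such sets are
  subsets of a fixed finite set.\<close>

lemma finite_characteristic_formulae:
  assumes "finite (dom \<tau>)"
  shows "finite (characteristic_formula \<tau> C \<rho> m ` {c. length c = k})"
proof (induction m arbitrary: k)
  case 0
  let ?E = "equality_atoms k :: 'a fm set" and ?L = "Lit ` {L. literal_over \<tau> k L}"
  have "characteristic_formula \<tau> C \<rho> 0 ` {c. length c = k} \<subseteq>
      (\<lambda>(X, Y). And (big_and X) (big_and Y)) ` (Pow ?E \<times> Pow ?L)"
  proof (rule image_subsetI)
    fix c :: "'b list" assume "c \<in> {c. length c = k}"
    then have k: "length c = k" by simp
    show "characteristic_formula \<tau> C \<rho> 0 c \<in>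
        (\<lambda>(X, Y). And (big_and X) (big_and Y)) ` (Pow ?E \<times> Pow ?L)"
      unfolding characteristic_formula.simps equality_formula_def k
      using equality_formula_atoms[of c] k by (intro image_eqI[OF _ SigmaI]) auto
  qed
  moreover have "finite (Pow ?E \<times> Pow ?L)"
    using finite_literal_over[OF assms] by auto
  ultimately show ?case by (meson finite_imageI finite_subset)
next
  case (Suc m)
  let ?F = "characteristic_formula \<tau> C \<rho> m ` {c. length c = Suc k}"
  \<comment> \<open>Such a formula is determined by its set of existential conjuncts and its set of
    disjuncts, both built from the finitely many formulae of rank \<open>m\<close> for tuples of
    length \<open>Suc k\<close>.\<close>
  have "characteristic_formula \<tau> C \<rho> (Suc m) ` {c. length c = k} \<subseteq>
      (\<lambda>(X, Y). And (big_and X) (All k (big_or Y))) ` (Pow (Ex k ` ?F) \<times> Pow ?F)"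
  proof (rule image_subsetI)
    fix c :: "'b list" assume "c \<in> {c. length c = k}"
    then have k: "length c = k" by simp
    show "characteristic_formula \<tau> C \<rho> (Suc m) c \<in>
        (\<lambda>(X, Y). And (big_and X) (All k (big_or Y))) ` (Pow (Ex k ` ?F) \<times> Pow ?F)"
      unfolding characteristic_formula.simps k
      using k by (intro image_eqI[OF _ SigmaI]) auto
  qed
  then show ?case using Suc.IH by (meson finite_Pow_iff finite_SigmaI finite_imageI finite_subset)
qed

lemma finite_characteristic_extensions:
  assumes "finite (dom \<tau>)"
  shows "finite ((\<lambda>x. characteristic_formula \<tau> C \<rho> m (c @ [x])) ` X)"
  by (rule finite_subset[OF _ finite_characteristic_formulae[OF assms, of C \<rho> m "Suc (length c)"]])
    auto

lemma finite_Ex_characteristic_extensions: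
  assumes "finite (dom \<tau>)"
  shows "finite ((\<lambda>x. Ex k (characteristic_formula \<tau> C \<rho> m (c @ [x]))) ` X)"
  using finite_imageI[OF finite_characteristic_extensions[OF assms], of "Ex k" C \<rho> m c X]
  by (simp add: image_image)

text \<open>Makes characteristic formulae admissible test formulae for \<open>equiv_rank\<close>.
  Each level binds the variable \<open>length c\<close>, exactly the one that the extended tuple
  adds.\<close>

lemma ranked_characteristic_formula:
  assumes "finite (dom \<tau>)"
  shows "ranked_formula \<tau> (length c) m (characteristic_formula \<tau> C \<rho> m c)"
proof (induction m arbitrary: c)
  case 0
  let ?Ls = "Lit ` {L. literal_over \<tau> (length c) L \<and> \<rho> (inst c L) = True}"
  have "ranked_formula \<tau> (length c) 0 (big_and ?Ls)"
  proof (rule ranked_formula_big_and)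
    show "finite ?Ls"
      by (rule finite_imageI, rule finite_subset[OF _ finite_literal_over[OF assms]]) auto
  next
    fix \<phi> assume "\<phi> \<in> ?Ls"
    then show "ranked_formula \<tau> (length c) 0 \<phi>"
      by (auto simp: ranked_formula_def) (use literal_over_iff in blast)
  qed
  then show ?case
    using ranked_equality_formula[of \<tau> c 0] by (simp add: ranked_formula_def)
next
  case (Suc m)
  have IH: "ranked_formula \<tau> (Suc (length c)) m (characteristic_formula \<tau> C \<rho> m (c @ [x]))" for x
    using Suc.IH[of "c @ [x]"] by simp
  have "ranked_formula \<tau> (length c) (Suc m)
      (big_and ((\<lambda>x. Ex (length c) (characteristic_formula \<tau> C \<rho> m (c @ [x]))) ` C))"
    by (rule ranked_formula_big_and[OF finite_Ex_characteristic_extensions[OF assms]])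
      (use IH in \<open>fastforce simp: ranked_formula_def less_Suc_eq\<close>)
  moreover have "ranked_formula \<tau> (Suc (length c)) m
      (big_or ((\<lambda>x. characteristic_formula \<tau> C \<rho> m (c @ [x])) ` C))"
    by (rule ranked_formula_big_or[OF finite_characteristic_extensions[OF assms]]) (use IH in auto)
  ultimately show ?case
    by (fastforce simp: ranked_formula_def less_Suc_eq)
qed

section \<open>One-sided back-and-forth systems\<close>

text \<open>The Ehrenfeucht-Fraisse recursion, free of both strategies and formulae; it mediates
  between the two. Moves go both ways, but the final comparison of literals only from
  \<open>\<rho>0\<close> to \<open>\<rho>1\<close>.\<close>

primrec one_sided_bf ::
  "'r vocabulary \<Rightarrow> 'u set \<Rightarrow> ('r, 'u, bool) interp \<Rightarrow> 'u set \<Rightarrow> ('r, 'u, bool) interp \<Rightarrow>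
   nat \<Rightarrow> 'u list \<Rightarrow> 'u list \<Rightarrow> bool" where
  "one_sided_bf \<tau> C \<rho>0 D \<rho>1 0 = (\<lambda>c d. winning_final \<tau> \<rho>0 c \<rho>1 d)"
| "one_sided_bf \<tau> C \<rho>0 D \<rho>1 (Suc m) = (\<lambda>c d.
     (\<forall>x\<in>C. \<exists>y\<in>D. one_sided_bf \<tau> C \<rho>0 D \<rho>1 m (c @ [x]) (d @ [y])) \<and>
     (\<forall>y\<in>D. \<exists>x\<in>C. one_sided_bf \<tau> C \<rho>0 D \<rho>1 m (c @ [x]) (d @ [y])))"

text \<open>Duplicator copies every move of Spoiler.\<close>

lemma one_sided_bf_refl: "one_sided_bf \<tau> C \<rho> C \<rho> m c c"
  by (induction m arbitrary: c) (auto simp: winning_final_def)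

lemma inst_append:
  assumes "literal_over \<tau> (length c) L"
  shows "inst (c @ xs) L = inst c L"
  unfolding inst_def
  by (rule lit.map_cong) (use assms in \<open>cases L; auto simp: nth_append\<close>)+

lemma winning_final_append:
  assumes "winning_final \<tau> \<rho>0 (c @ [x]) \<rho>1 (d @ [y])" "length c = length d"
  shows "winning_final \<tau> \<rho>0 c \<rho>1 d"
  unfolding winning_final_def
proof (intro conjI allI impI)
  fix i j assume "i < length c" "j < length c"
  then show "c ! i = c ! j \<longleftrightarrow> d ! i = d ! j"
    using assms(1)[unfolded winning_final_def, THEN conjunct1, rule_format, of i j] assms(2)
    by (simp add: nth_append)
next
  fix L assume L: "literal_over \<tau> (length c) L"
  have "literal_over \<tau> (length (c @ [x])) L"
    using L by (cases L) auto
  then have "\<rho>0 (inst (c @ [x]) L) \<le> \<rho>1 (inst (d @ [y]) L)"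
    using assms(1) unfolding winning_final_def by blast
  then show "\<rho>0 (inst c L) \<le> \<rho>1 (inst d L)"
    using L assms(2) by (simp add: inst_append)
qed

text \<open>The recursion tests tuples only at rank 0. Playing the remaining rounds arbitrarily,
  which needs an element of \<open>C\<close>, yields extensions that pass the test, and the test is
  inherited by prefixes.\<close>

lemma one_sided_bf_winning_final:
  assumes "one_sided_bf \<tau> C \<rho>0 D \<rho>1 m c d" "length c = length d" "C \<noteq> {}"
  shows "winning_final \<tau> \<rho>0 c \<rho>1 d"
  using assms(1,2)
proof (induction m arbitrary: c d)
  case (Suc m)
  from \<open>C \<noteq> {}\<close> Suc.prems obtain x y where "one_sided_bf \<tau> C \<rho>0 D \<rho>1 m (c @ [x]) (d @ [y])"
    by fastforce
  then have "winning_final \<tau> \<rho>0 (c @ [x]) \<rho>1 (d @ [y])"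
    using Suc by simp
  then show ?case using Suc.prems(2) by (rule winning_final_append)
qed auto

text \<open>
  The map \<open>f\<close> sends a variable to the position of its current value in the tuples; it need
  not be the identity, since a formula may quantify the same variable repeatedly.
\<close>

lemma one_sided_bf_preserves:
  assumes "one_sided_bf \<tau> C \<rho>0 D \<rho>1 m c d" "length c = length d" "C \<noteq> {}"
    and "in_vocabulary \<tau> \<phi>" "quantifier_rank \<phi> \<le> m"
    and "\<And>i. i \<in> free_vars \<phi> \<Longrightarrow> f i < length c \<and> e i = c ! f i \<and> e' i = d ! f i"
    and "satisfies C \<rho>0 e \<phi>"
  shows "satisfies D \<rho>1 e' \<phi>"
  using assms(1,2,4-)
proof (induction \<phi> arbitrary: m c d f e e')
  case (Eq i j)
  from one_sided_bf_winning_final[OF Eq.prems(1,2) \<open>C \<noteq> {}\<close>] Eq.prems show ?case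
    by (simp add: winning_final_def)
next
  case (Neq i j)
  from one_sided_bf_winning_final[OF Neq.prems(1,2) \<open>C \<noteq> {}\<close>] Neq.prems show ?case
    by (simp add: winning_final_def)
next
  case (Lit L)
  from Lit.prems obtain k where "literal_over \<tau> k L" by auto
  \<comment> \<open>Renaming variables to positions turns \<open>L\<close> into one of the literals
    compared by \<open>winning_final\<close>.\<close>
  then have "literal_over \<tau> (length c) (map_lit f L)"
    by (rule literal_over_map_lit) (use Lit.prems in auto)
  then have "\<rho>0 (inst c (map_lit f L)) \<le> \<rho>1 (inst d (map_lit f L))"
    using one_sided_bf_winning_final[OF Lit.prems(1,2) \<open>C \<noteq> {}\<close>] by (simp add: winning_final_def)
  moreover have "inst c (map_lit f L) = map_lit e L" "inst d (map_lit f L) = map_lit e' L"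
    unfolding inst_def lit.map_comp
    by (rule lit.map_cong; use Lit.prems in auto)+
  ultimately show ?case using Lit.prems by simp
next
  case (Or \<phi> \<psi>)
  from Or.prems(6) consider "satisfies C \<rho>0 e \<phi>" | "satisfies C \<rho>0 e \<psi>" by auto
  then show ?case
  proof cases
    case 1
    have "satisfies D \<rho>1 e' \<phi>"
      by (rule Or.IH(1)[OF Or.prems(1,2) _ _ _ 1]) (use Or.prems in auto)
    then show ?thesis by simp
  next
    case 2
    have "satisfies D \<rho>1 e' \<psi>"
      by (rule Or.IH(2)[OF Or.prems(1,2) _ _ _ 2]) (use Or.prems in auto)
    then show ?thesis by simp
  qed
next
  case (And \<phi> \<psi>)
  from And.prems(6) have sat: "satisfies C \<rho>0 e \<phi>" "satisfies C \<rho>0 e \<psi>" by auto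
  have "satisfies D \<rho>1 e' \<phi>"
    by (rule And.IH(1)[OF And.prems(1,2) _ _ _ sat(1)]) (use And.prems in auto)
  moreover have "satisfies D \<rho>1 e' \<psi>"
    by (rule And.IH(2)[OF And.prems(1,2) _ _ _ sat(2)]) (use And.prems in auto)
  ultimately show ?case by simp
next
  case (Ex i \<phi>)
  from Ex.prems(4) obtain m' where m: "m = Suc m'" "quantifier_rank \<phi> \<le> m'" by (cases m) auto
  from Ex.prems(6) obtain x where x: "x \<in> C" "satisfies C \<rho>0 (e(i := x)) \<phi>" by auto
  with Ex.prems(1) m obtain y where y: "y \<in> D" "one_sided_bf \<tau> C \<rho>0 D \<rho>1 m' (c @ [x]) (d @ [y])"
    by auto
  \<comment> \<open>The variable \<open>i\<close> is redirected to position \<open>length c\<close>,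
    where the new elements stand; any earlier position of \<open>i\<close> is forgotten.\<close>
  have "satisfies D \<rho>1 (e'(i := y)) \<phi>"
  proof (rule Ex.IH[OF y(2) _ _ m(2) _ x(2)])
    fix j assume "j \<in> free_vars \<phi>"
    then show "(f(i := length c)) j < length (c @ [x]) \<and>
        (e(i := x)) j = (c @ [x]) ! (f(i := length c)) j \<and>
        (e'(i := y)) j = (d @ [y]) ! (f(i := length c)) j"
      using Ex.prems(2) Ex.prems(5)[of j] by (auto simp: nth_append)
  qed (use Ex.prems in auto)
  with y(1) show ?case by auto
next
  case (All i \<phi>)
  from All.prems(4) obtain m' where m: "m = Suc m'" "quantifier_rank \<phi> \<le> m'" by (cases m) auto
  have "satisfies D \<rho>1 (e'(i := y)) \<phi>" if "y \<in> D" for y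
  proof -
    \<comment> \<open>The back move: an arbitrary \<open>y\<close> is answered by some
      \<open>x\<close>, where the universal formula already holds, and truth is then carried from
      \<open>x\<close> to \<open>y\<close>.\<close>
    from that All.prems(1) m obtain x
      where x: "x \<in> C" "one_sided_bf \<tau> C \<rho>0 D \<rho>1 m' (c @ [x]) (d @ [y])" by auto
    with All.prems(6) have sat: "satisfies C \<rho>0 (e(i := x)) \<phi>" by auto
    show ?thesis
    proof (rule All.IH[OF x(2) _ _ m(2) _ sat])
      fix j assume "j \<in> free_vars \<phi>"
      then show "(f(i := length c)) j < length (c @ [x]) \<and>
        (e(i := x)) j = (c @ [x]) ! (f(i := length c)) j \<and>
          (e'(i := y)) j = (d @ [y]) ! (f(i := length c)) j"
        using All.prems(2) All.prems(5)[of j] by (auto simp: nth_append)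
    qed (use All.prems in auto)
  qed
  then show ?case by simp
qed auto

text \<open>The formula transcribes the recursion: the existential conjuncts answer moves in
  \<open>C\<close>, the universal disjunction answers moves in \<open>D\<close>, and rank 0 states
  the final winning condition.\<close>

lemma satisfies_characteristic_formula:
  assumes "finite (dom \<tau>)" "length c = length d"
  shows "satisfies D \<rho>1 (\<lambda>i. d ! i) (characteristic_formula \<tau> C \<rho>0 m c) \<longleftrightarrow>
    one_sided_bf \<tau> C \<rho>0 D \<rho>1 m c d"
  using assms(2)
proof (induction m arbitrary: c d)
  case 0
  have "finite (Lit ` {L. literal_over \<tau> (length c) L \<and> \<rho>0 (inst c L) = True})"
    by (rule finite_imageI, rule finite_subset[OF _ finite_literal_over[OF assms(1)]]) auto
  from satisfies_big_and[OF this] show ?case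
    by (auto simp: satisfies_equality_formula winning_final_def inst_def)
next
  case (Suc m)
  \<comment> \<open>The bound variable \<open>length c\<close> is the position of \<open>y\<close>
    in \<open>d @ [y]\<close> because the tuples have equal length. The two environments are only
    known to agree up to there, which suffices for the free variables.\<close>
  have ext: "satisfies D \<rho>1 ((\<lambda>i. d ! i)(length c := y)) (characteristic_formula \<tau> C \<rho>0 m (c @ [x]))
      \<longleftrightarrow> one_sided_bf \<tau> C \<rho>0 D \<rho>1 m (c @ [x]) (d @ [y])" for x y
  proof -
    have "satisfies D \<rho>1 ((\<lambda>i. d ! i)(length c := y)) (characteristic_formula \<tau> C \<rho>0 m (c @ [x])) =
        satisfies D \<rho>1 (\<lambda>i. (d @ [y]) ! i) (characteristic_formula \<tau> C \<rho>0 m (c @ [x]))"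
    proof (rule satisfies_cong)
      fix i assume "i \<in> free_vars (characteristic_formula \<tau> C \<rho>0 m (c @ [x]))"
      then have "i < Suc (length c)"
        using ranked_characteristic_formula[OF assms(1), of "c @ [x]" m C \<rho>0]
        by (auto simp: ranked_formula_def)
      then show "((\<lambda>i. d ! i)(length c := y)) i = (d @ [y]) ! i"
        using Suc.prems by (auto simp: nth_append)
    qed
    with Suc.IH[of "c @ [x]" "d @ [y]"] Suc.prems show ?thesis by simp
  qed
  show ?case
    by (simp add: satisfies_big_and[OF finite_Ex_characteristic_extensions[OF assms(1)]]
        satisfies_big_or[OF finite_characteristic_extensions[OF assms(1)]] ext)
qed

section \<open>The one-sided game\<close>

lemma rounds_Cons:
  "rounds \<sigma> (mv # ms) = round_pair mv (\<sigma> [mv]) # rounds (\<lambda>ms. \<sigma> (mv # ms)) ms"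
  unfolding rounds_def by (simp add: map_upt_Suc del: upt_Suc)

lemma rounds_cong:
  assumes "\<And>ms'. ms' \<noteq> [] \<Longrightarrow> \<sigma> ms' = \<sigma>' ms'"
  shows "rounds \<sigma> ms = rounds \<sigma>' ms"
  unfolding rounds_def by (intro map_cong refl arg_cong2[where f = round_pair] assms) auto

text \<open>No strategy is consulted on the empty history. This matters because the value at
  \<open>[]\<close> of a strategy shifted past its first move is the reply already given.\<close>

lemma winning_strategy_cong:
  assumes "\<And>ms. ms \<noteq> [] \<Longrightarrow> \<sigma> ms = \<sigma>' ms"
  shows "winning_strategy \<tau> m C \<rho>0 c D \<rho>1 d \<sigma> = winning_strategy \<tau> m C \<rho>0 c D \<rho>1 d \<sigma>'"
  using assms rounds_cong[OF assms] unfolding winning_strategy_def by auto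

text \<open>Peels off the first round: the rest is a game on the extended tuples, played by the same
  strategy with \<open>mv\<close> prefixed to every history.\<close>

lemma winning_strategy_Suc:
  "winning_strategy \<tau> (Suc m) C \<rho>0 c D \<rho>1 d \<sigma> \<longleftrightarrow>
     (\<forall>mv. legal_move C D mv \<longrightarrow> legal_reply C D mv (\<sigma> [mv]) \<and>
        winning_strategy \<tau> m C \<rho>0 (c @ [fst (round_pair mv (\<sigma> [mv]))])
          D \<rho>1 (d @ [snd (round_pair mv (\<sigma> [mv]))]) (\<lambda>ms. \<sigma> (mv # ms)))"
  (is "?l \<longleftrightarrow> ?r")
proof
  assume l: ?l
  show ?r
  proof (intro allI impI conjI)
    fix mv assume mv: "legal_move C D mv"
    then show "legal_reply C D mv (\<sigma> [mv])"
      using l[unfolded winning_strategy_def, THEN conjunct1, rule_format, of "[mv]"] by simp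
    show "winning_strategy \<tau> m C \<rho>0 (c @ [fst (round_pair mv (\<sigma> [mv]))])
          D \<rho>1 (d @ [snd (round_pair mv (\<sigma> [mv]))]) (\<lambda>ms. \<sigma> (mv # ms))"
      unfolding winning_strategy_def
    proof (intro conjI allI impI)
      fix ms assume "ms \<noteq> [] \<and> length ms \<le> m \<and> list_all (legal_move C D) ms"
      with mv show "legal_reply C D (last ms) (\<sigma> (mv # ms))"
        using l[unfolded winning_strategy_def, THEN conjunct1, rule_format, of "mv # ms"] by simp
    next
      fix ms assume "length ms = m \<and> list_all (legal_move C D) ms"
      with mv show "winning_final \<tau> \<rho>0
          ((c @ [fst (round_pair mv (\<sigma> [mv]))]) @ map fst (rounds (\<lambda>ms. \<sigma> (mv # ms)) ms)) \<rho>1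
          ((d @ [snd (round_pair mv (\<sigma> [mv]))]) @ map snd (rounds (\<lambda>ms. \<sigma> (mv # ms)) ms))"
        using l[unfolded winning_strategy_def, THEN conjunct2, rule_format, of "mv # ms"]
        by (simp add: rounds_Cons)
    qed
  qed
next
  assume r: ?r
  show ?l
    unfolding winning_strategy_def
  proof (intro conjI allI impI)
    fix ms assume ms: "ms \<noteq> [] \<and> length ms \<le> Suc m \<and> list_all (legal_move C D) ms"
    then obtain mv ms' where "ms = mv # ms'" by (cases ms) auto
    with ms r show "legal_reply C D (last ms) (\<sigma> ms)"
      unfolding winning_strategy_def by (cases "ms' = []") auto
  next
    fix ms assume ms: "length ms = Suc m \<and> list_all (legal_move C D) ms"
    then obtain mv ms' where "ms = mv # ms'" by (cases ms) auto
    with ms r show "winning_final \<tau> \<rho>0 (c @ map fst (rounds \<sigma> ms)) \<rho>1 (d @ map snd (rounds \<sigma> ms))"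
      unfolding winning_strategy_def by (auto simp: rounds_Cons)
  qed
qed

lemma ex_winning_strategy_Suc:
  "(\<exists>\<sigma>. winning_strategy \<tau> (Suc m) C \<rho>0 c D \<rho>1 d \<sigma>) \<longleftrightarrow>
     (\<forall>mv. legal_move C D mv \<longrightarrow> (\<exists>r. legal_reply C D mv r \<and>
        (\<exists>\<sigma>. winning_strategy \<tau> m C \<rho>0 (c @ [fst (round_pair mv r)])
          D \<rho>1 (d @ [snd (round_pair mv r)]) \<sigma>)))"
  (is "?l \<longleftrightarrow> ?r")
proof
  assume ?l
  then show ?r unfolding winning_strategy_Suc by blast
next
  assume ?r
  then obtain r S where rS: "\<And>mv. legal_move C D mv \<Longrightarrow> legal_reply C D mv (r mv) \<and>
      winning_strategy \<tau> m C \<rho>0 (c @ [fst (round_pair mv (r mv))])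
          D \<rho>1 (d @ [snd (round_pair mv (r mv))]) (S mv)"
    by metis
  \<comment> \<open>Glues the chosen first replies \<open>r\<close> and continuations
    \<open>S\<close> into one strategy: a history of length one is answered by \<open>r\<close>, a
    longer one by the continuation for its first move.\<close>
  define \<sigma> where "\<sigma> ms = (if tl ms = [] then r (hd ms) else S (hd ms) (tl ms))" for ms
  have "winning_strategy \<tau> m C \<rho>0 c' D \<rho>1 d' (\<lambda>ms. \<sigma> (mv # ms)) =
      winning_strategy \<tau> m C \<rho>0 c' D \<rho>1 d' (S mv)" for mv c' d'
    by (rule winning_strategy_cong) (simp add: \<sigma>_def)
  moreover have "\<sigma> [mv] = r mv" for mv by (simp add: \<sigma>_def)
  ultimately have "winning_strategy \<tau> (Suc m) C \<rho>0 c D \<rho>1 d \<sigma>"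
    unfolding winning_strategy_Suc using rS by simp
  then show ?l by blast
qed

lemma ex_winning_strategy_iff:
  "(\<exists>\<sigma>. winning_strategy \<tau> m C \<rho>0 c D \<rho>1 d \<sigma>) \<longleftrightarrow> one_sided_bf \<tau> C \<rho>0 D \<rho>1 m c d"
proof (induction m arbitrary: c d)
  case 0
  show ?case by (auto simp: winning_strategy_def rounds_def)
next
  case (Suc m)
  \<comment> \<open>Splitting by the universe of the move produces the two conjuncts of
    \<open>one_sided_bf\<close>.\<close>
  have all_move: "(\<forall>mv. P mv) \<longleftrightarrow> (\<forall>x. P (First x)) \<and> (\<forall>y. P (Second y))"
    for P :: "'a move \<Rightarrow> bool"
    by (metis move.exhaust)
  show ?case
    unfolding ex_winning_strategy_Suc Suc.IH all_move by auto
qed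

section \<open>The homomorphism game\<close>

lemma duplicator_wins_HG_iff:
  "duplicator_wins_HG \<tau> m H A \<pi>A a B \<pi>B b \<longleftrightarrow>
     (\<forall>h\<in>H. one_sided_bf \<tau> A (h \<circ> \<pi>A) B (h \<circ> \<pi>B) m a b \<and>
            one_sided_bf \<tau> B (h \<circ> \<pi>B) A (h \<circ> \<pi>A) m b a)"
  (is "?l \<longleftrightarrow> ?r")
proof
  assume ?l
  then show ?r unfolding duplicator_wins_HG_def ex_winning_strategy_iff[symmetric] by blast
next
  assume ?r
  \<comment> \<open>A strategy is chosen for each homomorphism and direction, that is, for each
    opening move of Spoiler.\<close>
  then obtain S T where ST: "\<And>h. h \<in> H \<Longrightarrow>
      winning_strategy \<tau> m A (h \<circ> \<pi>A) a B (h \<circ> \<pi>B) b (S h) \<and>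
      winning_strategy \<tau> m B (h \<circ> \<pi>B) b A (h \<circ> \<pi>A) a (T h)"
    unfolding ex_winning_strategy_iff[symmetric] by metis
  show ?l
    unfolding duplicator_wins_HG_def
    by (rule exI[of _ "\<lambda>h dir. if dir then S h else T h"]) (simp add: ST)
qed

theorem theorem5p6:
  fixes H :: "('s::{comm_semiring_1, canonically_ordered_monoid_add} \<Rightarrow> bool) set"
    and isum iprod :: "('u \<Rightarrow> 's) \<Rightarrow> 'u set \<Rightarrow> 's"
    and \<tau> :: "'r vocabulary"
    and A B :: "'u set"
    and \<pi>A \<pi>B :: "('r, 'u, 's) interp"
    and a b :: "'u list"
    and n m :: nat
  assumes "infinitary_operations isum iprod"
    and "\<forall>h\<in>H. semiring_hom h"
    and "infinite A \<longrightarrow> (\<forall>h\<in>H. infinitary_compatible isum iprod A h)"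
    and "infinite B \<longrightarrow> (\<forall>h\<in>H. infinitary_compatible isum iprod B h)"
    and "separating H"
    and "finite (dom \<tau>)"
    and "A \<noteq> {}" and "B \<noteq> {}"
    and "set a \<subseteq> A" and "length a = n"
    and "set b \<subseteq> B" and "length b = n"
  shows "(duplicator_wins_HG \<tau> m H A \<pi>A a B \<pi>B b \<longleftrightarrow>
          (\<forall>h\<in>H. h (eval_tuple isum iprod B \<pi>B (characteristic_formula \<tau> A (h \<circ> \<pi>A) m a) b) = True \<and>
                 h (eval_tuple isum iprod A \<pi>A (characteristic_formula \<tau> B (h \<circ> \<pi>B) m b) a) = True))
       \<and> ((\<forall>h\<in>H. h (eval_tuple isum iprod B \<pi>B (characteristic_formula \<tau> A (h \<circ> \<pi>A) m a) b) = True \<and>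
                 h (eval_tuple isum iprod A \<pi>A (characteristic_formula \<tau> B (h \<circ> \<pi>B) m b) a) = True)
          \<longleftrightarrow> equiv_rank isum iprod \<tau> n m A \<pi>A a B \<pi>B b)"
proof -
  note finite_dom = assms(6)
  have len: "length a = length b" using assms(10,12) by simp
  have hom_A: "h (eval_tuple isum iprod A \<pi>A \<phi> c) = satisfies A (h \<circ> \<pi>A) (\<lambda>i. c ! i) \<phi>"
    if "h \<in> H" for h \<phi> c
    unfolding eval_tuple_def
    by (rule hom_eval) (use that assms(1-3) infinitary_compatible_finite in blast)+
  have hom_B: "h (eval_tuple isum iprod B \<pi>B \<phi> c) = satisfies B (h \<circ> \<pi>B) (\<lambda>i. c ! i) \<phi>"
    if "h \<in> H" for h \<phi> c
    unfolding eval_tuple_def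
    by (rule hom_eval) (use that assms(1,2,4) infinitary_compatible_finite in blast)+
  have chi: "(\<forall>h\<in>H. h (eval_tuple isum iprod B \<pi>B (characteristic_formula \<tau> A (h \<circ> \<pi>A) m a) b) = True \<and>
                 h (eval_tuple isum iprod A \<pi>A (characteristic_formula \<tau> B (h \<circ> \<pi>B) m b) a) = True)
      \<longleftrightarrow> (\<forall>h\<in>H. one_sided_bf \<tau> A (h \<circ> \<pi>A) B (h \<circ> \<pi>B) m a b \<and>
                 one_sided_bf \<tau> B (h \<circ> \<pi>B) A (h \<circ> \<pi>A) m b a)" (is "?chi \<longleftrightarrow> ?bf")
    by (simp add: hom_A hom_B satisfies_characteristic_formula finite_dom len)
  have "equiv_rank isum iprod \<tau> n m A \<pi>A a B \<pi>B b" if bf: ?bf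
    unfolding equiv_rank_def
  proof (intro allI impI)
    fix \<phi> assume \<phi>: "in_vocabulary \<tau> \<phi> \<and> free_vars \<phi> \<subseteq> {..<n} \<and> quantifier_rank \<phi> \<le> m"
    have "h (eval_tuple isum iprod A \<pi>A \<phi> a) = h (eval_tuple isum iprod B \<pi>B \<phi> b)" if "h \<in> H" for h
    proof -
      have "satisfies B (h \<circ> \<pi>B) (\<lambda>i. b ! i) \<phi>" if "satisfies A (h \<circ> \<pi>A) (\<lambda>i. a ! i) \<phi>"
        \<comment> \<open>Initially each free variable is below \<open>n\<close> and is its own
          position in the tuple.\<close>
        by (rule one_sided_bf_preserves[where f = id, OF _ len \<open>A \<noteq> {}\<close> _ _ _ that])
          (use bf \<open>h \<in> H\<close> \<phi> assms(10) in auto)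
      moreover have "satisfies A (h \<circ> \<pi>A) (\<lambda>i. a ! i) \<phi>" if "satisfies B (h \<circ> \<pi>B) (\<lambda>i. b ! i) \<phi>"
        by (rule one_sided_bf_preserves[where f = id, OF _ len[symmetric] \<open>B \<noteq> {}\<close> _ _ _ that])
          (use bf \<open>h \<in> H\<close> \<phi> assms(12) in auto)
      ultimately show ?thesis using hom_A hom_B \<open>h \<in> H\<close> by blast
    qed
    \<comment> \<open>No \<open>h\<close> in \<open>H\<close> distinguishes the two values, so
      separation forces them to be equal.\<close>
    then show "eval_tuple isum iprod A \<pi>A \<phi> a = eval_tuple isum iprod B \<pi>B \<phi> b"
      using assms(5) unfolding separating_def by blast
  qed
  moreover have ?chi if eq: "equiv_rank isum iprod \<tau> n m A \<pi>A a B \<pi>B b"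
  proof
    fix h assume h: "h \<in> H"
    have transfer: "eval_tuple isum iprod A \<pi>A (characteristic_formula \<tau> C \<rho> m c) a =
        eval_tuple isum iprod B \<pi>B (characteristic_formula \<tau> C \<rho> m c) b" if "length c = n" for C \<rho> c
      using eq ranked_characteristic_formula[OF finite_dom, of c m C \<rho>] that
      unfolding equiv_rank_def ranked_formula_def by blast
    show "h (eval_tuple isum iprod B \<pi>B (characteristic_formula \<tau> A (h \<circ> \<pi>A) m a) b) = True \<and>
        h (eval_tuple isum iprod A \<pi>A (characteristic_formula \<tau> B (h \<circ> \<pi>B) m b) a) = True"
      \<comment> \<open>Equivalence moves each characteristic formula back to the interpretation and
        tuple it was built from, where it holds by reflexivity.\<close>
      unfolding transfer[OF assms(10), symmetric] transfer[OF assms(12)]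
      by (simp add: hom_A[OF h] hom_B[OF h] satisfies_characteristic_formula finite_dom
          one_sided_bf_refl)
  qed
  ultimately show ?thesis
    unfolding duplicator_wins_HG_iff using chi by blast
qed

end
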